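(* Let $\mathbf{A},\mathbf{B}\in\mathbb{C}^{n\times n}$ with $\mathbf{A}$ singular, $\operatorname{Ind}\mathbf{A}=k$ and $\operatorname{rank}\mathbf{A}^{k+1}=\operatorname{rank}\mathbf{A}^{k}=r\ge 1$. For $l\ge 0$ put $\widehat{\mathbf{B}}^{(l)}=\mathbf{A}^{l}\mathbf{B}=(\widehat{b}^{(l)}_{ij})$ (so $\widehat b^{(0)}_{ij}=b_{ij}$), with $j$th column $\widehat{\mathbf{b}}^{(l)}_{.j}$. Consider the partial (particular) solution $$\mathbf{X}(t)=\mathbf{A}^{D}\mathbf{B}+\sum_{s=1}^{k}\frac{(-1)^{s-1}}{s!}\left(\mathbf{A}^{s-1}\mathbf{B}-\mathbf{A}^{D}\mathbf{A}^{s}\mathbf{B}\right)t^{s}$$ of the matrix differential equation $\mathbf{X}'+\mathbf{A}\mathbf{X}=\mathbf{B}$. Then its entries $x_{ij}=x_{ij}(t)$ have the determinantal representation $$x_{ij}=\frac{\sum_{\beta\in J_{r,n}\{i\}}\left|\left(\mathbf{A}^{k+1}_{.i}\left(\widehat{\mathbf{b}}^{(k)}_{.j}\right)\right)^{\beta}_{\beta}\right|}{\sum_{\beta\in J_{r,n}}\left|\left(\mathbf{A}^{k+1}\right)^{\beta}_{\beta}\right|}+\sum_{s=1}^{k}\frac{(-1)^{s-1}}{s!}\left(\widehat{b}^{(s-1)}_{ij}-\frac{\sum_{\beta\in J_{r,n}\{i\}}\left|\left(\mathbf{A}^{k+1}_{.i}\left(\widehat{\mathbf{b}}^{(k+s)}_{.j}\right)\right)^{\beta}_{\beta}\right|}{\sum_{\beta\in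 J_{r,n}}\left|\left(\mathbf{A}^{k+1}\right)^{\beta}_{\beta}\right|}\right)t^{s}$$ for all $i,j=1,\dots,n$.
   Context: For $\mathbf{A}\in\mathbb{C}^{n\times n}$, the index $\operatorname{Ind}\mathbf{A}$ is the smallest nonnegative integer $k$ with $\operatorname{rank}\mathbf{A}^{k+1}=\operatorname{rank}\mathbf{A}^{k}$. The Drazin inverse $\mathbf{A}^{D}$ of a matrix with $\operatorname{Ind}\mathbf A=k$ is the unique matrix $\mathbf{X}$ satisfying $\mathbf{A}^{k+1}\mathbf{X}=\mathbf{A}^{k}$, $\mathbf{X}\mathbf{A}\mathbf{X}=\mathbf{X}$, $\mathbf{A}\mathbf{X}=\mathbf{X}\mathbf{A}$. In the differential equation the unknown $\mathbf{X}=\mathbf{X}(t)$ is an $n\times n$ complex-matrix-valued function of the real variable $t$ and $'$ denotes $d/dt$. Notation: for a matrix $\mathbf{M}$ and a column vector $\mathbf{b}$, $\mathbf{M}_{.i}(\mathbf{b})$ is the matrix obtained from $\mathbf{M}$ by replacing its $i$th column with $\mathbf{b}$; $\mathbf{A}^{k+1}_{.i}(\mathbf{b})$ means $(\mathbf{A}^{k+1})_{.i}(\mathbf{b})$. $|\mathbf{M}^{\beta}_{\beta}|$ is the principal minor of $\mathbf{M}$ with rows and columns indexed by $\beta$. For $1\le r\le n$, $J_{r,n}$ is the set of all strictly increasing sequences of $r$ integers from $\{1,\dots,n\}$ (equivalently, $r$-element subsets), and $J_{r,n}\{i\}=\{\beta\in J_{r,n}: i\in\beta\}$. *)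

theory Defs
  imports
    Complex_Main
    "Jordan_Normal_Form.Determinant"
    "Jordan_Normal_Form.DL_Rank"
    "Jordan_Normal_Form.DL_Submatrix"
begin

definition mat_index :: "complex mat \<Rightarrow> nat" where
  "mat_index A =
     (LEAST k. vec_space.rank (dim_row A) (A ^\<^sub>m (k + 1)) = vec_space.rank (dim_row A) (A ^\<^sub>m k))"

definition is_drazin_inverse :: "complex mat \<Rightarrow> complex mat \<Rightarrow> bool" where
  "is_drazin_inverse A X \<longleftrightarrow>
     X \<in> carrier_mat (dim_row A) (dim_row A) \<and>
     A ^\<^sub>m (mat_index A + 1) * X = A ^\<^sub>m (mat_index A) \<and>
     X * A * X = X \<and>
     A * X = X * A"

definition drazin_inverse :: "complex mat \<Rightarrow> complex mat" where
  "drazin_inverse A = (THE X. is_drazin_inverse A X)"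

(* Rows and columns of matrices are numbered from 0, so index sets are subsets of {0..<n}. *)
definition index_sets :: "nat \<Rightarrow> nat \<Rightarrow> nat set set" where
  "index_sets r n = {\<beta>. \<beta> \<subseteq> {0..<n} \<and> card \<beta> = r}"

definition index_sets_through :: "nat \<Rightarrow> nat \<Rightarrow> nat \<Rightarrow> nat set set" where
  "index_sets_through r n i = {\<beta> \<in> index_sets r n. i \<in> \<beta>}"

definition principal_minor :: "complex mat \<Rightarrow> nat set \<Rightarrow> complex" where
  "principal_minor M \<beta> = det (submatrix M \<beta> \<beta>)"

(* The type of matrices of arbitrary dimension carries no norm, so the derivative of a
   matrix-valued function of a real variable is taken entrywise. *)
definition has_mat_derivative :: "(real \<Rightarrow> complex mat) \<Rightarrow> complex mat \<Rightarrow> real \<Rightarrow> bool" where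
  "has_mat_derivative X D t \<longleftrightarrow>
     (\<forall>s. X s \<in> carrier_mat (dim_row D) (dim_col D)) \<and>
     (\<forall>i < dim_row D. \<forall>j < dim_col D.
        ((\<lambda>s. X s $$ (i, j)) has_vector_derivative D $$ (i, j)) (at t))"

(* X' + A X = B on the whole real line *)
definition solves_matrix_ode :: "complex mat \<Rightarrow> complex mat \<Rightarrow> (real \<Rightarrow> complex mat) \<Rightarrow> bool" where
  "solves_matrix_ode A B X \<longleftrightarrow>
     (\<exists>X'. \<forall>t. has_mat_derivative X (X' t) t \<and> X' t + A * X t = B)"

end

(* Put M = A^(k+1).  A column x of D A^m B, where D is the Drazin inverse of A, lies in the image
   of M and solves M x = c for the matching column c of A^(k+m) B.  Apply Cramer's rule to tI + M,
   for which (tI + M) x = c + t x, expand all determinants in principal minors and compare the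
   coefficients of t^(n-r).  The determinant that has x as a column does not contribute: it
   would need minors of size r+1 of a matrix whose columns lie in the image of M, which has
   rank r.  The denominator is nonzero because for a rank factorization M = PQ the identity
   t^r det(tI + PQ) = t^n det(tI + QP) turns it into det(QP), and QP is invertible since M and M^2
   have the same rank.  The differential equation is a telescoping sum. *)

theory Submission
  imports Defs "Jordan_Normal_Form.DL_Rank_Submatrix"
begin

section \<open>Rank factorizations\<close>

context vec_space
begin

text \<open>A maximal independent set of columns exists by finiteness. It spans every column, since
  a column outside its span could be added without losing independence.\<close>

lemma rank_basis:
  assumes A: "A \<in> carrier_mat n nc"
  obtains U where "finite U" "U \<subseteq> set (cols A)" "lin_indpt U" "card U = rank A"
    "span U = col_space A"
proof -
  have sub: "set (cols A) \<subseteq> carrier_vec n"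
    using A cols_dim by blast
  obtain U where fin: "finite U"
    and max: "maximal U (\<lambda>T. T \<subseteq> set (cols A) \<and> lin_indpt T)"
    using maximal_exists[of "\<lambda>T. T \<subseteq> set (cols A) \<and> lin_indpt T" "card (set (cols A))" "{}"]
    by (meson List.finite_set card_mono empty_iff empty_subsetI finite_lin_indpt2 rev_finite_subset)
  have U: "U \<subseteq> set (cols A)" "lin_indpt U"
    using max by (auto simp: maximal_def)
  have Uc: "U \<subseteq> carrier_vec n"
    using U sub by blast
  have "v \<in> span U" if v: "v \<in> set (cols A)" for v
  proof (rule ccontr)
    assume nin: "v \<notin> span U"
    have "lin_indpt (insert v U)"
      using lin_dep_iff_in_span[of U v] U Uc nin sub v span_mem[of U v]
      by (metis Un_commute insert_is_Un module_vec_simps(3) subsetD)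
    then have "insert v U = U"
      using max U v unfolding maximal_def by blast
    then have "v \<in> span U"
      using span_mem[of U v] Uc by auto
    with nin show False ..
  qed
  then have "span U = span (set (cols A))"
    using U Uc sub by (metis span_is_monotone span_subsetI subsetI subset_antisym)
  then show ?thesis
    using that[OF fin U] rank_card_indpt[OF A max] by (simp add: col_space_def)
qed

lemma col_space_mult_subset:
  assumes A: "A \<in> carrier_mat n m" and B: "B \<in> carrier_mat m p"
  shows "col_space (A * B) \<subseteq> col_space A"
proof -
  have AB: "A * B \<in> carrier_mat n p" using A B by simp
  show ?thesis
    unfolding col_space_eq[OF AB] col_space_eq[OF A]
    using A B by (auto simp: assoc_mult_mat_vec[OF A B] intro!: bexI[of _ "B *\<^sub>v _"])
qed

text \<open>Steinitz exchange between bases V and U of the two column spaces: V is completed by a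
  set C of at most |U| - |V| vectors to span the larger space. This bounds |V|, and equal ranks
  leave C empty.\<close>

lemma rank_mono_col_space:
  assumes A: "A \<in> carrier_mat n m" and B: "B \<in> carrier_mat n p"
    and sub: "col_space B \<subseteq> col_space A"
  shows "rank B \<le> rank A"
    and "rank B = rank A \<Longrightarrow> col_space B = col_space A"
proof -
  obtain U where U: "finite U" "U \<subseteq> set (cols A)" "lin_indpt U" "card U = rank A"
    "span U = col_space A"
    using rank_basis[OF A] .
  obtain V where V: "finite V" "V \<subseteq> set (cols B)" "lin_indpt V" "card V = rank B"
    "span V = col_space B"
    using rank_basis[OF B] .
  have Uc: "U \<subseteq> carrier_vec n" using U(2) A cols_dim by blast
  have Vc: "V \<subseteq> carrier_vec n" using V(2) B cols_dim by blast
  have "V \<subseteq> span U"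
    using in_own_span[of V] Vc sub unfolding U(5) V(5) by auto
  then obtain C where C: "finite C" "int (card C) \<le> int (card U) - int (card V)"
    "span (V \<union> C) = span U"
    using replacement[OF V(1) U(1) _ V(3)] Uc by auto
  show "rank B \<le> rank A" using C U V by linarith
  show "col_space B = col_space A" if "rank B = rank A"
  proof -
    have "C = {}" using C U V that by simp
    then show ?thesis using C U V by simp
  qed
qed

lemma rank_mult_le:
  assumes "A \<in> carrier_mat n m" and "B \<in> carrier_mat m p"
  shows "rank (A * B) \<le> rank A"
  using assms by (meson rank_mono_col_space(1) col_space_mult_subset mult_carrier_mat)

lemma right_factor_exists:
  assumes A: "A \<in> carrier_mat n m" and B: "B \<in> carrier_mat n p"
    and sub: "set (cols B) \<subseteq> col_space A"
  obtains Y where "Y \<in> carrier_mat m p" "B = A * Y"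
proof -
  have "\<exists>x. x \<in> carrier_vec m \<and> A *\<^sub>v x = col B j" if "j < p" for j
  proof -
    have "col B j \<in> col_space A"
      using sub that B by (auto simp: cols_def)
    then show ?thesis using A by (auto simp: col_space_eq[OF A])
  qed
  then obtain x where x: "\<And>j. j < p \<Longrightarrow> x j \<in> carrier_vec m \<and> A *\<^sub>v x j = col B j"
    by metis
  define Y where "Y = mat_of_cols m (map x [0..<p])"
  have Y: "Y \<in> carrier_mat m p"
    unfolding Y_def by (metis length_map length_upt mat_of_cols_carrier(1) minus_nat.diff_0)
  have "col Y j = x j" if "j < p" for j
    using that x unfolding Y_def by (subst col_mat_of_cols) auto
  then have "B = A * Y"
    using A B Y x by (intro mat_col_eqI) (auto simp: col_mult2[OF A Y] simp del: col_mult)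
  with Y that show ?thesis by blast
qed

text \<open>The column space of AB lies in that of A, so equal ranks make them equal, and every
  column of A is a combination of columns of AB. This turns rank equalities into matrix
  equations.\<close>

lemma rank_mult_eq_imp_factor:
  assumes A: "A \<in> carrier_mat n m" and B: "B \<in> carrier_mat m p"
    and eq: "rank (A * B) = rank A"
  obtains Y where "Y \<in> carrier_mat p m" "A = A * B * Y"
proof -
  have AB: "A * B \<in> carrier_mat n p" using A B by simp
  have "col_space (A * B) = col_space A"
    using rank_mono_col_space(2)[OF A AB col_space_mult_subset[OF A B]] eq by simp
  then have "set (cols A) \<subseteq> col_space (A * B)"
    using in_own_span[of "set (cols A)"] A cols_dim[of A] by (auto simp: col_space_def)
  from right_factor_exists[OF AB A this] that show ?thesis by blast
qed

text \<open>The columns of P are a basis of the column space of A, and Q records the coordinates of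
  the columns of A in it.\<close>

lemma rank_factorization:
  assumes A: "A \<in> carrier_mat n nc"
  obtains P Q where "P \<in> carrier_mat n (rank A)" "Q \<in> carrier_mat (rank A) nc" "A = P * Q"
proof -
  obtain U where U: "finite U" "U \<subseteq> set (cols A)" "card U = rank A" "span U = col_space A"
    using rank_basis[OF A] by metis
  obtain us where us: "set us = U" "distinct us"
    using finite_distinct_list[OF U(1)] by blast
  have len: "length us = rank A" using us U by (metis distinct_card)
  have Uc: "U \<subseteq> carrier_vec n" using U(2) A cols_dim by blast
  define P where "P = mat_of_cols n us"
  have P: "P \<in> carrier_mat n (rank A)" by (simp add: P_def len[symmetric])
  have "cols P = us" using Uc us by (simp add: P_def)
  then have "col_space P = col_space A" using U us by (simp add: col_space_def)
  then have "set (cols A) \<subseteq> col_space P"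
    using in_own_span[of "set (cols A)"] A cols_dim[of A] by (auto simp: col_space_def)
  from right_factor_exists[OF P A this] that P show ?thesis by metis
qed

end

text \<open>With a rank factorization C = C1 C2, the left factor P C1 has only rank C many
  columns.\<close>

lemma rank_triple_product_le:
  fixes P C Q :: "'a::field mat"
  assumes P: "P \<in> carrier_mat n l" and C: "C \<in> carrier_mat l m" and Q: "Q \<in> carrier_mat m p"
  shows "vec_space.rank n (P * C * Q) \<le> vec_space.rank l C"
proof -
  obtain C1 C2 where C12: "C1 \<in> carrier_mat l (vec_space.rank l C)"
    "C2 \<in> carrier_mat (vec_space.rank l C) m" "C = C1 * C2"
    using vec_space.rank_factorization[OF C] .
  have "P * C * Q = (P * C1) * (C2 * Q)"
    using P Q C12(1,2) unfolding C12(3)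
    by (smt (verit) assoc_mult_mat mult_carrier_mat)
  then have "vec_space.rank n (P * C * Q) \<le> vec_space.rank n (P * C1)"
    using vec_space.rank_mult_le[of "P * C1" n "vec_space.rank l C" "C2 * Q" p] P Q C12(1,2)
    by (metis mult_carrier_mat)
  also have "\<dots> \<le> vec_space.rank l C"
    using vec_space.rank_le_nc[of "P * C1" n] P C12 by simp
  finally show ?thesis .
qed

text \<open>The outer factors cannot raise the rank, so C has full rank r. It is applied to the
  middle factors QP and QAP that arise from rank factorizations.\<close>

lemma det_middle_nonzero:
  fixes P C Q :: "'a::field mat"
  assumes "P \<in> carrier_mat n r" and C: "C \<in> carrier_mat r r" and "Q \<in> carrier_mat r p"
    and "vec_space.rank n (P * C * Q) = r"
  shows "det C \<noteq> 0"
  using rank_triple_product_le[of P n r C r Q p] vec_space.det_rank_iff[OF C]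
    vec_space.rank_le_nc[OF C] assms by simp

section \<open>Drazin inverses in monoids\<close>

lemma (in monoid) nat_pow_left_commute:
  fixes m :: nat
  assumes "x \<in> carrier G"
  shows "x [^] m \<otimes> x = x \<otimes> x [^] m"
    and "z \<in> carrier G \<Longrightarrow> x [^] m \<otimes> (x \<otimes> z) = x \<otimes> (x [^] m \<otimes> z)"
  using group_commutes_pow[of x x m] assms by (simp_all add: m_assoc[symmetric])

lemma (in monoid) power_absorb_right:
  assumes "a \<in> carrier G" "y \<in> carrier G" "a [^] k = a [^] Suc k \<otimes> y"
  shows "a [^] k = a [^] (k + m) \<otimes> y [^] (m::nat)"
proof (induction m)
  case (Suc m)
  have "a [^] (k + m) = a [^] m \<otimes> a [^] k"
    using assms(1) by (simp add: nat_pow_mult add.commute)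
  \<comment> \<open>The hypothesis is used exactly once; as a rewrite rule it would loop, because
    a^(k+1) unfolds to a^k times a.\<close>
  also have "\<dots> = a [^] m \<otimes> (a [^] Suc k \<otimes> y)"
    by (rule arg_cong[OF assms(3)])
  also have "\<dots> = a [^] (m + Suc k) \<otimes> y"
    using assms(1,2) by (simp only: m_assoc[symmetric] nat_pow_closed nat_pow_mult)
  finally have "a [^] k = a [^] (m + Suc k) \<otimes> y \<otimes> y [^] m"
    using Suc by argo
  also have "\<dots> = a [^] (k + Suc m) \<otimes> y [^] Suc m"
    using assms(1,2) by (simp add: m_assoc nat_pow_left_commute add.commute)
  finally show ?case .
qed (use assms(1) in simp)

text \<open>From a^k y = z a^k follows a^k y^m = z^m a^k for all m. So the candidate a^k y^(k+1) can
  also be written with z on the left, and multiplying it by a on either side gives a^k y^k.\<close>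

lemma (in monoid) drazin_exists:
  assumes a: "a \<in> carrier G" and y: "y \<in> carrier G" and z: "z \<in> carrier G"
    and ay: "a [^] k = a [^] Suc k \<otimes> y" and za: "a [^] k = z \<otimes> a [^] Suc k"
  obtains x where "x \<in> carrier G" "a [^] Suc k \<otimes> x = a [^] k" "x \<otimes> a \<otimes> x = x"
    "a \<otimes> x = x \<otimes> a"
proof -
  \<comment> \<open>Both sides equal z a^(k+1) y.\<close>
  have "a [^] k \<otimes> y = z \<otimes> a [^] k"
  proof -
    have "a [^] k \<otimes> y = z \<otimes> (a [^] Suc k \<otimes> y)"
      using a y z by (subst za) (simp add: m_assoc)
    then show ?thesis by (simp only: ay[symmetric])
  qed
  then have swap: "a [^] k \<otimes> y [^] m = z [^] m \<otimes> a [^] k" for m :: nat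
  proof (induction m)
    case (Suc m)
    have "a [^] k \<otimes> y [^] Suc m = (a [^] k \<otimes> y [^] m) \<otimes> y"
      using a y by (simp add: m_assoc)
    also have "\<dots> = z [^] m \<otimes> (a [^] k \<otimes> y)"
      using Suc a y z by (simp add: m_assoc)
    also have "\<dots> = z [^] Suc m \<otimes> a [^] k"
      using Suc a y z by (simp add: m_assoc)
    finally show ?case .
  qed (use a y z in simp)
  define x where "x = a [^] k \<otimes> y [^] Suc k"
  have xz: "x = z [^] Suc k \<otimes> a [^] k" using swap[of "Suc k"] by (simp only: x_def)
  have x: "x \<in> carrier G" using a y by (simp add: x_def)
  have ax: "a \<otimes> x = a [^] k \<otimes> y [^] k"
  proof -
    have "a \<otimes> x = (a [^] Suc k \<otimes> y) \<otimes> y [^] k"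
      unfolding x_def using a y
      by (simp add: m_assoc nat_pow_left_commute)
    then show ?thesis by (simp only: ay[symmetric])
  qed
  have xa: "x \<otimes> a = a [^] k \<otimes> y [^] k"
  proof -
    have "x \<otimes> a = z [^] k \<otimes> (z \<otimes> a [^] Suc k)"
      unfolding xz using a z by (simp add: m_assoc)
    then show ?thesis using swap by (simp only: za[symmetric])
  qed
  have comm: "a \<otimes> x = x \<otimes> a" using ax xa by simp
  \<comment> \<open>In a^(2k) y^k the hypothesis on y absorbs all k factors y.\<close>
  have aax: "a [^] k \<otimes> (a [^] k \<otimes> y [^] k) = a [^] k"
  proof -
    have "a [^] k \<otimes> (a [^] k \<otimes> y [^] k) = a [^] (k + k) \<otimes> y [^] k"
      using a y by (simp add: m_assoc[symmetric] nat_pow_mult)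
    then show ?thesis
      by (simp only: power_absorb_right[OF a y ay, of k, symmetric])
  qed
  show ?thesis
  proof (rule that[OF x _ _ comm])
    show "a [^] Suc k \<otimes> x = a [^] k"
      using aax a x by (simp add: m_assoc ax)
    \<comment> \<open>Writing xa as z^k a^k and x as a^k y^k y exposes the product a^k a^k y^k,
      which collapses to a^k.\<close>
    have "x \<otimes> a \<otimes> x = z [^] k \<otimes> (a [^] k \<otimes> (a [^] k \<otimes> y [^] k)) \<otimes> y"
    proof -
      have "x \<otimes> a \<otimes> x = z [^] k \<otimes> a [^] k \<otimes> (a [^] k \<otimes> (y [^] k \<otimes> y))"
        using a y by (simp only: xa swap[of k]) (simp add: x_def)
      then show ?thesis using a y z by (simp add: m_assoc)
    qed
    also have "\<dots> = x"
      using a y by (simp only: aax x_def swap[symmetric]) (simp add: m_assoc)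
    finally show "x \<otimes> a \<otimes> x = x" .
  qed
qed

text \<open>Since a and x commute, x = a x x, and each further use of this pulls out one more factor
  a.\<close>

lemma (in monoid) drazin_expand:
  assumes a: "a \<in> carrier G" and x: "x \<in> carrier G"
    and xax: "x \<otimes> a \<otimes> x = x" and comm: "a \<otimes> x = x \<otimes> a"
  shows "x = a [^] m \<otimes> x [^] Suc m"
proof (induction m)
  case (Suc m)
  have "a [^] m \<otimes> x [^] Suc m = a [^] m \<otimes> (x \<otimes> x [^] m)"
    using a x by (simp only: nat_pow_Suc2)
  also have "\<dots> = a [^] m \<otimes> (a \<otimes> x \<otimes> x \<otimes> x [^] m)"
    by (simp only: xax comm)
  also have "\<dots> = a [^] Suc m \<otimes> (x \<otimes> x \<otimes> x [^] m)"
    using a x by (simp add: m_assoc)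
  also have "\<dots> = a [^] Suc m \<otimes> x [^] Suc (Suc m)"
    using a x by (simp add: m_assoc nat_pow_left_commute)
  finally show ?case using Suc by argo
qed (use a x in simp)

text \<open>Both elements equal x a y: write x as x^(k+1) a^k and use a^k = a^(k+1) y; write y as
  a^k y^(k+1) and use a^k = x a^(k+1).\<close>

lemma (in monoid) drazin_unique:
  assumes a: "a \<in> carrier G" and x: "x \<in> carrier G" and y: "y \<in> carrier G"
    and x1: "a [^] Suc k \<otimes> x = a [^] k" and y1: "a [^] Suc k \<otimes> y = a [^] k"
    and x2: "x \<otimes> a \<otimes> x = x" and y2: "y \<otimes> a \<otimes> y = y"
    and x3: "a \<otimes> x = x \<otimes> a" and y3: "a \<otimes> y = y \<otimes> a"
  shows "x = y"
proof -
  have powc: "a [^] m \<otimes> x [^] l = x [^] l \<otimes> a [^] m" for m l :: nat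
    using group_commutes_pow[OF group_commutes_pow[OF x3[symmetric] x a, symmetric]] a x by simp
  note x' = drazin_expand[OF a x x2 x3, of k]
  have "x [^] Suc k \<otimes> a [^] k = x [^] Suc k \<otimes> a [^] k \<otimes> a \<otimes> y"
    using a x y y1 by (simp add: m_assoc)
  then have xy: "x = x \<otimes> a \<otimes> y"
    by (simp only: powc[symmetric] x'[symmetric])
  note y' = drazin_expand[OF a y y2 y3, of k]
  have "a [^] k \<otimes> y [^] Suc k = x \<otimes> a [^] Suc k \<otimes> y [^] Suc k"
    using x1 powc[of "Suc k" 1] x by simp
  also have "\<dots> = x \<otimes> a \<otimes> (a [^] k \<otimes> y [^] Suc k)"
    using a x y by (simp add: m_assoc nat_pow_left_commute[of a])
  finally have "y = x \<otimes> a \<otimes> y"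
    by (simp only: y'[symmetric])
  then show ?thesis using xy by argo
qed

section \<open>Expansion of determinants in principal minors\<close>

lemma bij_betw_pick:
  assumes "finite S"
  shows "bij_betw (pick S) {0..<card S} S"
proof -
  have inj: "inj_on (pick S) {0..<card S}"
    by (rule inj_onI) (metis atLeastLessThan_iff linorder_neqE_nat nat_less_le pick_mono_le)
  moreover have "pick S ` {0..<card S} \<subseteq> S"
    by (auto intro: pick_in_set_le)
  ultimately show ?thesis
    using assms by (auto simp: bij_betw_def card_image card_subset_eq)
qed

text \<open>Conjugation with the increasing enumeration of \<beta> carries permutations of positions
  to permutations of \<beta> and preserves signs. Free of renumbered indices, the minor can be
  recognized inside the expansion of a larger determinant.\<close>

lemma det_submatrix_principal:
  fixes N :: "'a::comm_ring_1 mat"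
  assumes N: "N \<in> carrier_mat n n" and b: "\<beta> \<subseteq> {0..<n}"
  shows "det (submatrix N \<beta> \<beta>) =
    (\<Sum>p\<in>{p. p permutes \<beta>}. signof p * (\<Prod>i\<in>\<beta>. N $$ (i, p i)))"
proof -
  have fin: "finite \<beta>" using b finite_subset by blast
  define m where "m = card \<beta>"
  define f where "f = pick \<beta>"
  have bij: "bij_betw f {0..<m} \<beta>"
    using bij_betw_pick[OF fin] by (simp add: f_def m_def)
  then have inj: "inj_on f {0..<m}" and im: "f ` {0..<m} = \<beta>"
    by (auto simp: bij_betw_def)
  define g where "g = inv_into {0..<m} f"
  have bij': "bij_betw g \<beta> {0..<m}"
    using bij by (simp add: g_def bij_betw_inv_into)
  have card: "card {i. i < n \<and> i \<in> \<beta>} = m"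
    unfolding m_def using b by (intro arg_cong[of _ _ card]) auto
  then have S: "submatrix N \<beta> \<beta> \<in> carrier_mat m m"
    using N by (intro carrier_matI) (auto simp: dim_submatrix)
  have entry: "submatrix N \<beta> \<beta> $$ (i, j) = N $$ (f i, f j)" if "i < m" "j < m" for i j
    using that N card by (subst submatrix_index) (auto simp: f_def)
  have "det (submatrix N \<beta> \<beta>) = (\<Sum>p\<in>{p. p permutes {0..<m}}.
      signof p * (\<Prod>i=0..<m. submatrix N \<beta> \<beta> $$ (i, p i)))"
    by (rule det_def'[OF S])
  also have "\<dots> = (\<Sum>p\<in>{p. p permutes \<beta>}. signof p * (\<Prod>i\<in>\<beta>. N $$ (i, p i)))"
  proof (rule sum.reindex_bij_witness[where j = "map_permutation {0..<m} f"
        and i = "map_permutation \<beta> g"])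
    fix p assume p: "p \<in> {p. p permutes {0..<m}}"
    then show "map_permutation {0..<m} f p \<in> {p. p permutes \<beta>}"
      using map_permutation_permutes[OF bij] by blast
    show "map_permutation \<beta> g (map_permutation {0..<m} f p) = p"
      using p inj by (intro map_permutation_compose_inv[OF bij]) (auto simp: g_def)
    have "(\<Prod>i\<in>\<beta>. N $$ (i, map_permutation {0..<m} f p i)) =
        (\<Prod>i=0..<m. N $$ (f i, map_permutation {0..<m} f p (f i)))"
      by (rule prod.reindex_bij_betw[OF bij, symmetric])
    also have "\<dots> = (\<Prod>i=0..<m. submatrix N \<beta> \<beta> $$ (i, p i))"
    proof (rule prod.cong[OF refl])
      fix i assume i: "i \<in> {0..<m}"
      then have "p i < m" using p permutes_in_image[of p "{0..<m}" i] by simp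
      then show "N $$ (f i, map_permutation {0..<m} f p (f i)) = submatrix N \<beta> \<beta> $$ (i, p i)"
        using i by (simp add: entry map_permutation_apply[OF inj])
    qed
    finally show "signof (map_permutation {0..<m} f p) *
        (\<Prod>i\<in>\<beta>. N $$ (i, map_permutation {0..<m} f p i)) =
        signof p * (\<Prod>i=0..<m. submatrix N \<beta> \<beta> $$ (i, p i))"
      using p by (simp add: sign_map_permutation[OF inj])
  next
    fix p assume p: "p \<in> {p. p permutes \<beta>}"
    then show "map_permutation \<beta> g p \<in> {p. p permutes {0..<m}}"
      using map_permutation_permutes[OF bij'] by blast
    show "map_permutation {0..<m} f (map_permutation \<beta> g p) = p"
      using p inj im
      by (intro map_permutation_compose_inv[OF bij']) (auto simp: g_def f_inv_into_f)
  qed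
  finally show ?thesis .
qed

text \<open>Multiply out each product of the Leibniz formula: \<beta> collects the rows whose entry
  comes from N, the other rows contribute the diagonal summand.\<close>

lemma det_add_diagonal:
  fixes N :: "'a::comm_ring_1 mat"
  assumes N: "N \<in> carrier_mat n n"
  shows "det (N + mat n n (\<lambda>(i, j). if i = j then d i else 0)) =
    (\<Sum>\<beta>\<in>Pow {0..<n}. (\<Prod>i\<in>{0..<n} - \<beta>. d i) * det (submatrix N \<beta> \<beta>))"
proof -
  let ?U = "{0..<n}"
  let ?d = "\<lambda>p i. if i = p i then d i else 0"
  have "det (N + mat n n (\<lambda>(i, j). if i = j then d i else 0)) =
    (\<Sum>p\<in>{p. p permutes ?U}. signof p * (\<Prod>i\<in>?U. N $$ (i, p i) + ?d p i))"
  proof (subst det_def'[of _ n], use N in simp, intro sum.cong refl arg_cong2[of _ _ _ _ "(*)"] prod.cong)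
    fix p i assume "p \<in> {p. p permutes ?U}" "i \<in> ?U"
    then show "(N + mat n n (\<lambda>(i, j). if i = j then d i else 0)) $$ (i, p i) = N $$ (i, p i) + ?d p i"
      using N permutes_in_image[of p ?U i] by simp
  qed
  also have "\<dots> = (\<Sum>p\<in>{p. p permutes ?U}. \<Sum>\<beta>\<in>Pow ?U.
      signof p * ((\<Prod>i\<in>\<beta>. N $$ (i, p i)) * (\<Prod>i\<in>?U - \<beta>. ?d p i)))"
    by (simp add: prod_add sum_distrib_left)
  also have "\<dots> = (\<Sum>\<beta>\<in>Pow ?U. \<Sum>p\<in>{p. p permutes ?U}.
      signof p * ((\<Prod>i\<in>\<beta>. N $$ (i, p i)) * (\<Prod>i\<in>?U - \<beta>. ?d p i)))"
    by (rule sum.swap)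
  also have "\<dots> = (\<Sum>\<beta>\<in>Pow ?U. (\<Prod>i\<in>?U - \<beta>. d i) * det (submatrix N \<beta> \<beta>))"
  proof (rule sum.cong[OF refl])
    fix \<beta> assume "\<beta> \<in> Pow ?U"
    then have b: "\<beta> \<subseteq> ?U" by simp
    have "(\<Sum>p\<in>{p. p permutes ?U}.
        signof p * ((\<Prod>i\<in>\<beta>. N $$ (i, p i)) * (\<Prod>i\<in>?U - \<beta>. ?d p i))) =
      (\<Sum>p\<in>{p. p permutes \<beta>}.
        signof p * ((\<Prod>i\<in>\<beta>. N $$ (i, p i)) * (\<Prod>i\<in>?U - \<beta>. ?d p i)))"
    \<comment> \<open>A permutation that moves an index outside \<beta> picks an off-diagonal zero
      there; the others are exactly the permutations of \<beta>.\<close>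
    proof (rule sum.mono_neutral_right)
      show "finite {p. p permutes ?U}" by (simp add: finite_permutations)
      show "{p. p permutes \<beta>} \<subseteq> {p. p permutes ?U}"
        using b permutes_subset by blast
      show "\<forall>p\<in>{p. p permutes ?U} - {p. p permutes \<beta>}.
        signof p * ((\<Prod>i\<in>\<beta>. N $$ (i, p i)) * (\<Prod>i\<in>?U - \<beta>. ?d p i)) = 0"
      proof
        fix p assume "p \<in> {p. p permutes ?U} - {p. p permutes \<beta>}"
        then obtain i where "i \<in> ?U - \<beta>" "p i \<noteq> i"
          using permutes_superset[of p ?U \<beta>] by auto
        then have "(\<Prod>i\<in>?U - \<beta>. ?d p i) = 0"
          by (intro prod_zero bexI[of _ i]) auto
        then show "signof p * ((\<Prod>i\<in>\<beta>. N $$ (i, p i)) * (\<Prod>i\<in>?U - \<beta>. ?d p i)) = 0"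
          by simp
      qed
    qed
    also have "\<dots> = (\<Sum>p\<in>{p. p permutes \<beta>}.
        signof p * ((\<Prod>i\<in>\<beta>. N $$ (i, p i)) * (\<Prod>i\<in>?U - \<beta>. d i)))"
      by (intro sum.cong refl arg_cong2[of _ _ _ _ "(*)"] prod.cong)
        (auto simp: permutes_not_in)
    also have "\<dots> = (\<Prod>i\<in>?U - \<beta>. d i) * det (submatrix N \<beta> \<beta>)"
      unfolding det_submatrix_principal[OF N b] sum_distrib_left by (simp add: ac_simps)
    finally show "(\<Sum>p\<in>{p. p permutes ?U}.
        signof p * ((\<Prod>i\<in>\<beta>. N $$ (i, p i)) * (\<Prod>i\<in>?U - \<beta>. ?d p i))) =
      (\<Prod>i\<in>?U - \<beta>. d i) * det (submatrix N \<beta> \<beta>)" .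
  qed
  finally show ?thesis .
qed

section \<open>Cramer's rule on the image of a matrix\<close>

text \<open>For S all index sets this is det (M + tI) as a polynomial in t; for the index sets
  through l it is the same determinant with the diagonal entry at l left unshifted.\<close>

definition minor_poly :: "complex mat \<Rightarrow> nat set set \<Rightarrow> complex poly" where
  "minor_poly M S = (\<Sum>\<beta>\<in>S. monom (principal_minor M \<beta>) (dim_row M - card \<beta>))"

lemma coeff_minor_poly:
  assumes M: "M \<in> carrier_mat n n" and S: "S \<subseteq> Pow {0..<n}" and m: "m \<le> n"
  shows "coeff (minor_poly M S) (n - m) = (\<Sum>\<beta>\<in>{\<beta>\<in>S. card \<beta> = m}. principal_minor M \<beta>)"
proof -
  have fin: "finite S" using S finite_subset by blast
  have card: "card \<beta> \<le> n" if "\<beta> \<in> S" for \<beta>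
    using S that card_mono[of "{0..<n}" \<beta>] by auto
  have "coeff (minor_poly M S) (n - m) =
      (\<Sum>\<beta>\<in>S. if n - card \<beta> = n - m then principal_minor M \<beta> else 0)"
    using M by (simp add: minor_poly_def coeff_sum)
  \<comment> \<open>Subtraction is truncated, but both cardinalities are at most n, so equal
    exponents mean equal cardinalities.\<close>
  also have "\<dots> = (\<Sum>\<beta>\<in>S. if card \<beta> = m then principal_minor M \<beta> else 0)"
    using card m by (intro sum.cong refl if_cong) (metis diff_diff_cancel)
  also have "\<dots> = (\<Sum>\<beta>\<in>{\<beta>\<in>S. card \<beta> = m}. principal_minor M \<beta>)"
    using fin by (simp add: sum.inter_filter)
  finally show ?thesis .
qed

lemma poly_minor_poly:
  assumes M: "M \<in> carrier_mat n n"
  shows "poly (minor_poly M (Pow {0..<n})) t = det (M + t \<cdot>\<^sub>m 1\<^sub>m n)"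
proof -
  have "M + t \<cdot>\<^sub>m 1\<^sub>m n = M + mat n n (\<lambda>(i, j). if i = j then t else 0)"
    using M by (intro eq_matI) auto
  moreover have "n - card \<beta> = card ({0..<n} - \<beta>)" if "\<beta> \<subseteq> {0..<n}" for \<beta>
    using that by (simp add: card_Diff_subset finite_subset)
  ultimately show ?thesis
    using M by (simp add: minor_poly_def poly_sum poly_monom det_add_diagonal[OF M]
        principal_minor_def mult.commute)
qed

text \<open>If an index set omits l, its complement contributes the zero diagonal summand at l as a
  factor.\<close>

lemma poly_minor_poly_through:
  assumes M: "M \<in> carrier_mat n n" and l: "l < n"
  shows "poly (minor_poly M {\<beta>\<in>Pow {0..<n}. l \<in> \<beta>}) t =
    det (M + mat n n (\<lambda>(i, j). if i = j then (if i = l then 0 else t) else 0))"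
proof -
  let ?d = "\<lambda>i. if i = l then 0 else t"
  have "(\<Prod>i\<in>{0..<n} - \<beta>. ?d i) = (if l \<in> \<beta> then t ^ (n - card \<beta>) else 0)"
    if b: "\<beta> \<subseteq> {0..<n}" for \<beta>
  proof (cases "l \<in> \<beta>")
    case True
    then have "(\<Prod>i\<in>{0..<n} - \<beta>. ?d i) = (\<Prod>i\<in>{0..<n} - \<beta>. t)"
      by (intro prod.cong) auto
    then show ?thesis
      using True b by (simp add: card_Diff_subset finite_subset)
  next
    case False
    then show ?thesis using l by (auto intro!: prod_zero bexI[of _ l])
  qed
  then have "det (M + mat n n (\<lambda>(i, j). if i = j then ?d i else 0)) =
    (\<Sum>\<beta>\<in>Pow {0..<n}. if l \<in> \<beta> then t ^ (n - card \<beta>) * principal_minor M \<beta> else 0)"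
    unfolding det_add_diagonal[OF M] principal_minor_def by (intro sum.cong) auto
  also have "\<dots> = poly (minor_poly M {\<beta>\<in>Pow {0..<n}. l \<in> \<beta>}) t"
    using M by (simp add: minor_poly_def poly_sum poly_monom mult.commute sum.inter_filter[symmetric] del: mem_Collect_eq Pow_iff)
  finally show ?thesis by simp
qed

section \<open>Nonvanishing of the denominator\<close>

text \<open>Two block triangular multipliers make the same block matrix N block triangular, once
  with PQ + tI and once with QP + tI on the diagonal. The block tI in the second multiplier yields
  the factor t^r and avoids a division by t.\<close>

lemma det_mult_swap_shift:
  fixes P Q :: "'a::idom mat"
  assumes P: "P \<in> carrier_mat n r" and Q: "Q \<in> carrier_mat r n"
  shows "det (P * Q + t \<cdot>\<^sub>m 1\<^sub>m n) * t ^ r = t ^ n * det (Q * P + t \<cdot>\<^sub>m 1\<^sub>m r)"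
proof -
  define N where "N = four_block_mat (t \<cdot>\<^sub>m 1\<^sub>m n) P (- Q) (1\<^sub>m r)"
  have N: "N \<in> carrier_mat (n + r) (n + r)" unfolding N_def by simp
  let ?L = "four_block_mat (1\<^sub>m n) (0\<^sub>m n r) Q (1\<^sub>m r)"
  let ?R = "four_block_mat (1\<^sub>m n) (- P) (0\<^sub>m r n) (t \<cdot>\<^sub>m 1\<^sub>m r)"
  have "N * ?L = four_block_mat (P * Q + t \<cdot>\<^sub>m 1\<^sub>m n) P (0\<^sub>m r n) (1\<^sub>m r)"
    unfolding N_def using P Q
    by (subst mult_four_block_mat[of _ n n _ r _ r _ _ n _ r])
      (auto intro!: cong_four_block_mat simp: comm_add_mat[of _ n n])
  then have "det N * det ?L = det (P * Q + t \<cdot>\<^sub>m 1\<^sub>m n)"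
    using P Q det_four_block_mat_lower_left_zero[of "P * Q + t \<cdot>\<^sub>m 1\<^sub>m n" n P r "0\<^sub>m r n" "1\<^sub>m r"]
    by (subst det_mult[symmetric, OF N]) auto
  moreover have "det ?L = 1"
    using Q by (subst det_four_block_mat_upper_right_zero[where n = n and m = r]) auto
  moreover have "t \<cdot>\<^sub>m 1\<^sub>m n * - P + P * (t \<cdot>\<^sub>m 1\<^sub>m r) = 0\<^sub>m n r"
    using P mult_smult_distrib[OF P, of "1\<^sub>m r" r t] mult_smult_assoc_mat[of "1\<^sub>m n" n n "- P" r t]
    by (intro eq_matI) auto
  then have "N * ?R = four_block_mat (t \<cdot>\<^sub>m 1\<^sub>m n) (0\<^sub>m n r) (- Q) (Q * P + t \<cdot>\<^sub>m 1\<^sub>m r)"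
    unfolding N_def using P Q
    by (subst mult_four_block_mat[of _ n n _ r _ r _ _ n _ r])
      (auto intro!: cong_four_block_mat)
  then have "det N * det ?R = t ^ n * det (Q * P + t \<cdot>\<^sub>m 1\<^sub>m r)"
    using P Q by (subst det_mult[symmetric, OF N]) (auto simp: det_four_block_mat_upper_right_zero[where n = n and m = r])
  moreover have "det ?R = t ^ r"
    using P by (subst det_four_block_mat_lower_left_zero[where n = n and m = r]) auto
  ultimately show ?thesis by simp
qed

text \<open>The sum is the coefficient of t^(n-r) in det (M + tI), which for M = PQ equals det (QP).
  The rank of M * M = P(QP)Q forces QP to be invertible.\<close>

lemma sum_principal_minors_nonzero:
  assumes M: "M \<in> carrier_mat n n"
    and r: "vec_space.rank n M = r" "vec_space.rank n (M * M) = r"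
  shows "(\<Sum>\<beta>\<in>index_sets r n. principal_minor M \<beta>) \<noteq> 0"
proof -
  obtain P Q where P: "P \<in> carrier_mat n r" and Q: "Q \<in> carrier_mat r n" and MPQ: "M = P * Q"
    using vec_space.rank_factorization[OF M] r by metis
  have rn: "r \<le> n" using vec_space.rank_le_nc[OF M] r by simp
  have QP: "Q * P \<in> carrier_mat r r" using P Q by simp
  have "M * M = P * (Q * P) * Q"
    using P Q unfolding MPQ by (smt (verit) assoc_mult_mat mult_carrier_mat)
  then have "det (Q * P) \<noteq> 0"
    using det_middle_nonzero[OF P QP Q] r by simp
  moreover have "minor_poly M (Pow {0..<n}) * monom 1 r = monom 1 n * minor_poly (Q * P) (Pow {0..<r})"
  proof (rule poly_eq_poly_eq_iff[THEN iffD1], rule ext)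
    fix t
    show "poly (minor_poly M (Pow {0..<n}) * monom 1 r) t =
        poly (monom 1 n * minor_poly (Q * P) (Pow {0..<r})) t"
      using det_mult_swap_shift[OF P Q, of t]
      by (simp add: poly_monom poly_minor_poly[OF M] poly_minor_poly[OF QP] MPQ[symmetric])
  qed
  \<comment> \<open>At exponent n the left side yields the coefficient of t^(n-r), the right side
    the constant term det (QP).\<close>
  then have "coeff (monom 1 r * minor_poly M (Pow {0..<n})) n =
      coeff (monom 1 n * minor_poly (Q * P) (Pow {0..<r})) n"
    by (simp add: mult.commute)
  then have "coeff (minor_poly M (Pow {0..<n})) (n - r) = poly (minor_poly (Q * P) (Pow {0..<r})) 0"
    using rn by (simp add: coeff_monom_mult poly_0_coeff_0)
  then have "coeff (minor_poly M (Pow {0..<n})) (n - r) = det (Q * P)"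
  proof -
    have "C + 0 \<cdot>\<^sub>m 1\<^sub>m r = C" if "C \<in> carrier_mat r r" for C :: "complex mat"
      using that by (intro eq_matI) auto
    note this[OF QP]
    with QP show ?thesis
      using \<open>coeff (minor_poly M (Pow {0..<n})) (n - r) = _\<close> by (simp add: poly_minor_poly[OF QP])
  qed
  moreover have "coeff (minor_poly M (Pow {0..<n})) (n - r) =
      (\<Sum>\<beta>\<in>index_sets r n. principal_minor M \<beta>)"
    unfolding coeff_minor_poly[OF M subset_refl rn] by (simp add: index_sets_def)
  ultimately show ?thesis by simp
qed

section \<open>Cramer's rule with principal minors\<close>

text \<open>The cofactors along column l do not depend on that column, so Laplace expansion is
  linear in it.\<close>

lemma det_replace_col_add:
  assumes M: "M \<in> carrier_mat n n" and l: "l < n"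
    and c: "c \<in> carrier_vec n" and x: "x \<in> carrier_vec n"
  shows "det (replace_col M (c + t \<cdot>\<^sub>v x) l) = det (replace_col M c l) + t * det (replace_col M x l)"
proof -
  have car: "replace_col M v l \<in> carrier_mat n n" for v
    using M by (simp add: replace_col_def)
  have "cofactor (replace_col M v l) i l = cofactor M i l" if "i < n" for v i
    unfolding cofactor_def using M l that
    by (intro arg_cong2[of _ _ _ _ "(*)"] arg_cong[of _ _ det] eq_matI)
      (auto simp: mat_delete_def replace_col_def)
  then have expand: "det (replace_col M v l) = (\<Sum>i<n. v $ i * cofactor M i l)" for v
    using M l unfolding laplace_expansion_column[OF car l]
    by (intro sum.cong) (auto simp: replace_col_def)
  have "det (replace_col M (c + t \<cdot>\<^sub>v x) l) =
      (\<Sum>i<n. c $ i * cofactor M i l + t * (x $ i * cofactor M i l))"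
    unfolding expand using c x by (intro sum.cong) (auto simp: algebra_simps)
  then show ?thesis
    by (simp only: expand sum.distrib sum_distrib_left)
qed

lemma principal_minor_eq_0:
  assumes M: "M \<in> carrier_mat n n" and b: "\<beta> \<subseteq> {0..<n}" and "vec_space.rank n M < card \<beta>"
  shows "principal_minor M \<beta> = 0"
proof (rule ccontr)
  assume "principal_minor M \<beta> \<noteq> 0"
  then have "card {j. j < n \<and> j \<in> \<beta>} \<le> vec_space.rank n M"
    unfolding principal_minor_def by (rule vec_space.rank_gt_minor[OF M])
  moreover have "{j. j < n \<and> j \<in> \<beta>} = \<beta>" using b by auto
  ultimately show False using assms by simp
qed

text \<open>Since x lies in the image of M, putting it into a column of M does not raise the rank.
  This removes the extra term of Cramer's rule for M + tI from the coefficient of t^(n-r), so M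
  itself may be singular.\<close>

lemma cramer_principal_minors:
  assumes M: "M \<in> carrier_mat n n" and rank: "vec_space.rank n M \<le> r" and rn: "r \<le> n"
    and w: "w \<in> carrier_vec n" and x: "x = M *\<^sub>v w" and l: "l < n"
  shows "(\<Sum>\<beta>\<in>index_sets_through r n l. principal_minor (replace_col M (M *\<^sub>v x) l) \<beta>) =
    x $ l * (\<Sum>\<beta>\<in>index_sets r n. principal_minor M \<beta>)"
proof -
  let ?S = "{\<beta>\<in>Pow {0..<n}. l \<in> \<beta>}"
  have sub: "?S \<subseteq> Pow {0..<n}" by auto
  define c where "c = M *\<^sub>v x"
  have xc: "x \<in> carrier_vec n" and c: "c \<in> carrier_vec n"
    using M w by (auto simp: x c_def)
  have car: "replace_col M v l \<in> carrier_mat n n" for v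
    using M by (simp add: replace_col_def)
  \<comment> \<open>Replacing column l overwrites the shifted diagonal entry at l, so only index
    sets through l remain.\<close>
  have shift: "det (replace_col (M + t \<cdot>\<^sub>m 1\<^sub>m n) v l) = poly (minor_poly (replace_col M v l) ?S) t" for t v
    unfolding poly_minor_poly_through[OF car l]
    using M by (intro arg_cong[of _ _ det] eq_matI) (auto simp: replace_col_def)
  have "[:x $ l:] * minor_poly M (Pow {0..<n}) =
    minor_poly (replace_col M c l) ?S + pCons 0 (minor_poly (replace_col M x l) ?S)"
  proof (rule poly_eq_poly_eq_iff[THEN iffD1], rule ext)
    fix t
    have K: "M + t \<cdot>\<^sub>m 1\<^sub>m n \<in> carrier_mat n n" using M by simp
    have "(M + t \<cdot>\<^sub>m 1\<^sub>m n) *\<^sub>v x = c + t \<cdot>\<^sub>v x"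
      using M xc by (intro eq_vecI) (auto simp: c_def add_mult_distrib_mat_vec[of _ n n])
    then have "x $ l * det (M + t \<cdot>\<^sub>m 1\<^sub>m n) = det (replace_col (M + t \<cdot>\<^sub>m 1\<^sub>m n) (c + t \<cdot>\<^sub>v x) l)"
      using cramer_lemma_mat[OF K xc l] by simp
    also have "\<dots> = det (replace_col (M + t \<cdot>\<^sub>m 1\<^sub>m n) c l) + t * det (replace_col (M + t \<cdot>\<^sub>m 1\<^sub>m n) x l)"
      by (rule det_replace_col_add[OF K l c xc])
    finally show "poly ([:x $ l:] * minor_poly M (Pow {0..<n})) t =
      poly (minor_poly (replace_col M c l) ?S + pCons 0 (minor_poly (replace_col M x l) ?S)) t"
      by (simp add: shift poly_minor_poly[OF M])
  qed
  then have "coeff ([:x $ l:] * minor_poly M (Pow {0..<n})) (n - r) =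
    coeff (minor_poly (replace_col M c l) ?S + pCons 0 (minor_poly (replace_col M x l) ?S)) (n - r)"
    by simp
  \<comment> \<open>\<open>pCons 0\<close> multiplies by t, so this coefficient consists of minors
    of size r + 1; for r = n it is the constant coefficient, which is 0.\<close>
  moreover have "coeff (pCons 0 (minor_poly (replace_col M x l) ?S)) (n - r) = 0"
  proof (cases "r = n")
    case False
    then have Suc: "Suc r \<le> n" "n - r = Suc (n - Suc r)" using rn by auto
    \<comment> \<open>Since x = Mw, replacing a column by x is right multiplication by the identity
      with that column replaced by w.\<close>
    have "replace_col M x l = M * replace_col (1\<^sub>m n) w l"
    proof (rule mat_col_eqI)
      fix j assume "j < dim_col (M * replace_col (1\<^sub>m n) w l)"
      then have j: "j < n" by (simp add: replace_col_def)
      have id: "replace_col (1\<^sub>m n) w l \<in> carrier_mat n n" by (simp add: replace_col_def)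
      have "col (M * replace_col (1\<^sub>m n) w l) j = M *\<^sub>v col (replace_col (1\<^sub>m n) w l) j"
        by (rule col_mult2[OF M id j])
      also have "col (replace_col (1\<^sub>m n) w l) j = (if j = l then w else col (1\<^sub>m n) j)"
        using w j by (intro eq_vecI) (auto simp: replace_col_def)
      also have "M *\<^sub>v \<dots> = (if j = l then x else col (M * 1\<^sub>m n) j)"
        by (cases "j = l") (simp_all only: x refl if_True if_False col_mult2[OF M one_carrier_mat j])
      also have "\<dots> = col (replace_col M x l) j"
        using M xc j by (intro eq_vecI) (auto simp: replace_col_def)
      finally show "col (replace_col M x l) j = col (M * replace_col (1\<^sub>m n) w l) j" by simp
    qed (use M in \<open>auto simp: replace_col_def\<close>)
    then have "vec_space.rank n (replace_col M x l) \<le> r"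
      using vec_space.rank_mult_le[OF M, of "replace_col (1\<^sub>m n) w l" n] rank
      by (simp add: replace_col_def)
    then have "(\<Sum>\<beta>\<in>{\<beta>\<in>?S. card \<beta> = Suc r}. principal_minor (replace_col M x l) \<beta>) = 0"
      by (intro sum.neutral ballI principal_minor_eq_0[OF car]) auto
    then show ?thesis
      unfolding Suc(2) coeff_pCons_Suc by (subst coeff_minor_poly[OF car]) (use Suc in auto)
  qed simp
  moreover have "{\<beta>\<in>?S. card \<beta> = r} = index_sets_through r n l"
    and "{\<beta>\<in>Pow {0..<n}. card \<beta> = r} = index_sets r n"
    by (auto simp: index_sets_through_def index_sets_def)
  ultimately show ?thesis
    using coeff_minor_poly[OF M subset_refl rn] coeff_minor_poly[OF car sub rn, of c]
    by (simp add: c_def)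
qed

section \<open>The Drazin inverse of a matrix\<close>

lemma pow_mat_add:
  fixes A :: "'a::comm_ring_1 mat"
  assumes A: "A \<in> carrier_mat n n"
  shows "A ^\<^sub>m (a + b) = A ^\<^sub>m a * A ^\<^sub>m b"
  using monoid.nat_pow_mult[OF ring.is_monoid[OF ring_mat], of A n "()" a b] A
  by (simp add: ring_mat_simps pow_mat_ring_pow[OF A, of _ "()"])

text \<open>Equal ranks give A^k = A^(k+1) Y, hence A^k = A^(k+m) Y^m, so the rank cannot drop
  later.\<close>

lemma rank_power_stable:
  fixes A :: "'a::field mat"
  assumes A: "A \<in> carrier_mat n n"
    and eq: "vec_space.rank n (A ^\<^sub>m Suc k) = vec_space.rank n (A ^\<^sub>m k)"
  shows "vec_space.rank n (A ^\<^sub>m (k + m)) = vec_space.rank n (A ^\<^sub>m k)"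
proof -
  interpret R: ring "ring_mat TYPE('a) n ()" by (rule ring_mat)
  note [simp] = ring_mat_simps and pow = pow_mat_ring_pow[of _ n _ "()"]
  have Ak: "A ^\<^sub>m j \<in> carrier_mat n n" for j using A by simp
  obtain Y where Y: "Y \<in> carrier_mat n n" and AY: "A ^\<^sub>m k = A ^\<^sub>m k * A * Y"
    using vec_space.rank_mult_eq_imp_factor[OF Ak[of k] A] eq by auto
  have "A ^\<^sub>m k = A ^\<^sub>m (k + m) * Y ^\<^sub>m m"
    using R.power_absorb_right[of A Y k m] A Y AY
    by (simp add: pow[OF A, symmetric] pow[OF Y, symmetric])
  then have "vec_space.rank n (A ^\<^sub>m k) \<le> vec_space.rank n (A ^\<^sub>m (k + m))"
    using vec_space.rank_mult_le[OF Ak[of "k + m"], of "Y ^\<^sub>m m" n] Y by simp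
  moreover have "vec_space.rank n (A ^\<^sub>m (k + m)) \<le> vec_space.rank n (A ^\<^sub>m k)"
    unfolding pow_mat_add[OF A] by (rule vec_space.rank_mult_le[OF Ak Ak])
  ultimately show ?thesis by simp
qed

text \<open>With a rank factorization \<open>A\<^sup>k = PQ\<close> the matrix \<open>QAP\<close> is invertible, and
  \<open>P(QAP)\<^sup>-\<^sup>1Q\<close> inverts \<open>A\<close> on both sides up to the factor \<open>A\<^sup>k\<close>.\<close>

lemma power_two_sided_absorb:
  fixes A :: "'a::field mat"
  assumes A: "A \<in> carrier_mat n n"
    and eq: "vec_space.rank n (A ^\<^sub>m Suc k) = vec_space.rank n (A ^\<^sub>m k)"
  obtains Y where "Y \<in> carrier_mat n n" "A ^\<^sub>m k = A ^\<^sub>m Suc k * Y" "A ^\<^sub>m k = Y * A ^\<^sub>m Suc k"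
proof -
  define r where "r = vec_space.rank n (A ^\<^sub>m k)"
  have Ak: "A ^\<^sub>m j \<in> carrier_mat n n" for j using A by simp
  obtain P Q where P: "P \<in> carrier_mat n r" and Q: "Q \<in> carrier_mat r n" and PQ: "A ^\<^sub>m k = P * Q"
    using vec_space.rank_factorization[OF Ak[of k]] unfolding r_def by metis
  define C where "C = Q * A * P"
  have C: "C \<in> carrier_mat r r" using P Q A by (simp add: C_def)
  \<comment> \<open>A^(2k+1) still has rank r, which makes its middle factor C invertible.\<close>
  have "A ^\<^sub>m (k + Suc k) = P * Q * A * (P * Q)"
    using pow_mat_add[OF A, of "Suc k" k] PQ by (simp add: add.commute)
  also have "\<dots> = P * C * Q"
    using P Q A unfolding C_def by (smt (verit) assoc_mult_mat mult_carrier_mat)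
  finally have "vec_space.rank n (P * C * Q) = r"
    using rank_power_stable[OF A eq, of "Suc k"] by (simp add: r_def)
  then have "det C \<noteq> 0" by (rule det_middle_nonzero[OF P C Q])
  then obtain I where I: "I \<in> carrier_mat r r" "C * I = 1\<^sub>m r" "I * C = 1\<^sub>m r"
    using det_non_zero_imp_unit[OF C, of "()"] by (auto simp: Units_def ring_mat_simps)
  define Y where "Y = P * I * Q"
  \<comment> \<open>The two forms of A^(k+1) place C = QAP next to its inverse in (PQA)(PIQ) and in
    (PIQ)(APQ).\<close>
  have Suc1: "A ^\<^sub>m Suc k = P * Q * A" by (simp add: PQ)
  have Suc2: "A ^\<^sub>m Suc k = A * (P * Q)"
    using pow_mat_add[OF A, of 1 k] A PQ by (simp add: left_mult_one_mat[OF A])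
  show ?thesis
  proof (rule that)
    show "Y \<in> carrier_mat n n" using P Q I by (simp add: Y_def)
    have "A ^\<^sub>m Suc k * Y = P * (C * I) * Q"
      using P Q A I(1) unfolding Suc1 Y_def C_def by (smt (verit) assoc_mult_mat mult_carrier_mat)
    then show "A ^\<^sub>m k = A ^\<^sub>m Suc k * Y" using P PQ I by simp
    have "Y * A ^\<^sub>m Suc k = P * (I * C) * Q"
      using P Q A I(1) unfolding Suc2 Y_def C_def by (smt (verit) assoc_mult_mat mult_carrier_mat)
    then show "A ^\<^sub>m k = Y * A ^\<^sub>m Suc k" using P PQ I by simp
  qed
qed

text \<open>The monoid lemmas, read in the ring of n by n matrices, give existence and uniqueness,
  so \<open>THE\<close> denotes the intended matrix. One Y serves as left and right
  absorber.\<close>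

lemma is_drazin_inverse_drazin_inverse:
  assumes A: "A \<in> carrier_mat n n" and k: "mat_index A = k"
    and eq: "vec_space.rank n (A ^\<^sub>m Suc k) = vec_space.rank n (A ^\<^sub>m k)"
  shows "is_drazin_inverse A (drazin_inverse A)"
proof -
  let ?R = "ring_mat TYPE(complex) n ()"
  interpret R: ring ?R by (rule ring_mat)
  note pow = pow_mat_ring_pow[OF A, of _ "()", symmetric]
  obtain Y where Y: "Y \<in> carrier_mat n n" "A ^\<^sub>m k = A ^\<^sub>m Suc k * Y" "A ^\<^sub>m k = Y * A ^\<^sub>m Suc k"
    using power_two_sided_absorb[OF A eq] .
  obtain X where "X \<in> carrier_mat n n" "A ^\<^sub>m Suc k * X = A ^\<^sub>m k" "X * A * X = X" "A * X = X * A"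
    using R.drazin_exists[of A Y Y k, unfolded pow ring_mat_simps, OF A Y(1) Y(1) Y(2) Y(3)] .
  then have ex: "is_drazin_inverse A X"
    using A k by (simp add: is_drazin_inverse_def)
  have "Z = X" if "is_drazin_inverse A Z" for Z
    using that ex A k R.drazin_unique[of A Z X k, unfolded pow ring_mat_simps]
    by (simp add: is_drazin_inverse_def)
  with ex show ?thesis
    unfolding drazin_inverse_def by (metis theI)
qed

text \<open>Let M = A^(k+1). The identity D = M D^(k+2) places each column of D A^m B in the image
  of M, and M D = A^k sends it to the matching column of A^(k+m) B. The case m = 0 serves the
  constant term of the solution, m = s the coefficient of t^s.\<close>

lemma drazin_entry_minors:
  assumes A: "A \<in> carrier_mat n n" and B: "B \<in> carrier_mat n n"
    and D: "D \<in> carrier_mat n n" "A ^\<^sub>m Suc k * D = A ^\<^sub>m k" "D * A * D = D" "A * D = D * A"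
    and r: "vec_space.rank n (A ^\<^sub>m Suc k) = r" "vec_space.rank n (A ^\<^sub>m k) = r"
    and i: "i < n" and j: "j < n"
  shows "(D * A ^\<^sub>m m * B) $$ (i, j) =
    (\<Sum>\<beta>\<in>index_sets_through r n i.
       principal_minor (replace_col (A ^\<^sub>m Suc k) (col (A ^\<^sub>m (k + m) * B) j) i) \<beta>)
    / (\<Sum>\<beta>\<in>index_sets r n. principal_minor (A ^\<^sub>m Suc k) \<beta>)"
proof -
  interpret R: ring "ring_mat TYPE(complex) n ()" by (rule ring_mat)
  define M where "M = A ^\<^sub>m Suc k"
  have Ap: "A ^\<^sub>m l \<in> carrier_mat n n" for l using A by simp
  have Dp: "D ^\<^sub>m l \<in> carrier_mat n n" for l using D by simp
  have M: "M \<in> carrier_mat n n" unfolding M_def by (rule Ap)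
  have AB: "A ^\<^sub>m m * B \<in> carrier_mat n n" by (rule mult_carrier_mat[OF Ap B])
  define W where "W = D ^\<^sub>m Suc (Suc k) * (A ^\<^sub>m m * B)"
  have W: "W \<in> carrier_mat n n"
    unfolding W_def by (rule mult_carrier_mat[OF Dp AB])
  define x where "x = col (D * A ^\<^sub>m m * B) j"
  have "D = M * D ^\<^sub>m Suc (Suc k)"
    using R.drazin_expand[of A D "Suc k", unfolded ring_mat_simps
        pow_mat_ring_pow[OF A, of _ "()", symmetric] pow_mat_ring_pow[OF D(1), of _ "()", symmetric],
        OF A D(1) D(3) D(4)] unfolding M_def .
  then have "D * A ^\<^sub>m m * B = M * W"
    unfolding W_def by (metis assoc_mult_mat[OF M Dp AB] assoc_mult_mat[OF D(1) Ap B])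
  then have xw: "x = M *\<^sub>v col W j"
    using j by (simp only: x_def col_mult2[OF M W])
  have DAB: "D * A ^\<^sub>m m * B \<in> carrier_mat n n"
    by (rule mult_carrier_mat[OF mult_carrier_mat[OF D(1) Ap] B])
  have "M * (D * A ^\<^sub>m m * B) = A ^\<^sub>m (k + m) * B"
    using D(2) unfolding M_def[symmetric] pow_mat_add[OF A]
    by (smt (verit) assoc_mult_mat mult_carrier_mat M D(1) Ap B)
  then have Mx: "M *\<^sub>v x = col (A ^\<^sub>m (k + m) * B) j"
    using j by (simp only: x_def col_mult2[OF M DAB, symmetric])
  \<comment> \<open>The exponent of M * M is 2k + 2 = k + (k + 2).\<close>
  have rM: "vec_space.rank n M = r" "vec_space.rank n (M * M) = r"
    using r rank_power_stable[OF A, of k "k + 2"] pow_mat_add[OF A, of "Suc k" "Suc k"]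
    by (simp_all add: M_def)
  have "r \<le> n" using vec_space.rank_le_nc[OF M] rM by simp
  then have "(\<Sum>\<beta>\<in>index_sets_through r n i. principal_minor (replace_col M (M *\<^sub>v x) i) \<beta>) =
    x $ i * (\<Sum>\<beta>\<in>index_sets r n. principal_minor M \<beta>)"
    using M W rM j i by (intro cramer_principal_minors[OF M _ _ _ xw]) auto
  moreover have "x $ i = (D * A ^\<^sub>m m * B) $$ (i, j)"
    unfolding x_def using i j carrier_matD[OF DAB] by (intro index_col) auto
  ultimately show ?thesis
    using sum_principal_minors_nonzero[OF M rM]
    unfolding M_def[symmetric] by (simp add: Mx nonzero_eq_divide_eq)
qed

section \<open>The differential equation\<close>

text \<open>Carrier and entries are proved in one induction, since the entries of a matrix sum are
  computed only for known dimensions.\<close>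

lemma finsum_module_mat:
  fixes f :: "'b \<Rightarrow> 'a::comm_ring_1 mat"
  assumes "finite S" and "\<And>s. s \<in> S \<Longrightarrow> f s \<in> carrier_mat nr nc"
  shows "finsum (module_mat TYPE('a) nr nc) f S \<in> carrier_mat nr nc"
    and "i < nr \<Longrightarrow> j < nc \<Longrightarrow>
      finsum (module_mat TYPE('a) nr nc) f S $$ (i, j) = (\<Sum>s\<in>S. f s $$ (i, j))"
proof -
  interpret V: abelian_group "module_mat TYPE('a) nr nc" by (rule abelian_group_mat)
  have "finsum (module_mat TYPE('a) nr nc) f S \<in> carrier_mat nr nc \<and>
    (\<forall>i<nr. \<forall>j<nc. finsum (module_mat TYPE('a) nr nc) f S $$ (i, j) = (\<Sum>s\<in>S. f s $$ (i, j)))"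
    using assms
  proof (induction S rule: finite_induct)
    case (insert s S)
    then have "f s \<in> carrier_mat nr nc" and "f \<in> S \<rightarrow> carrier_mat nr nc" by auto
    then have "finsum (module_mat TYPE('a) nr nc) f (insert s S) =
      f s + finsum (module_mat TYPE('a) nr nc) f S"
      using V.finsum_insert[of S s f] insert by (simp add: module_mat_simps)
    then show ?case using insert by auto
  qed (simp add: module_mat_simps)
  then show "finsum (module_mat TYPE('a) nr nc) f S \<in> carrier_mat nr nc"
    and "i < nr \<Longrightarrow> j < nc \<Longrightarrow>
      finsum (module_mat TYPE('a) nr nc) f S $$ (i, j) = (\<Sum>s\<in>S. f s $$ (i, j))"
    by auto
qed

text \<open>Summand s + 1 of the first sum and summand s of the second differ only in sign. Writing
  the remainder with (-1)^k covers k = 0, where both sides vanish.\<close>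

lemma alternating_sum_telescope:
  fixes g :: "nat \<Rightarrow> 'a::field_char_0"
  shows "(\<Sum>s=1..k. (-1) ^ (s - 1) / fact (s - 1) * t ^ (s - 1) * g s)
    + (\<Sum>s=1..k. (-1) ^ (s - 1) / fact s * t ^ s * g (Suc s))
    = g 1 - (-1) ^ k / fact k * t ^ k * g (Suc k)"
proof (induction k)
  case (Suc k)
  \<comment> \<open>The new summand \<open>?a\<close> of the first sum cancels the old remainder;
    \<open>?b\<close> from the second is the new one.\<close>
  let ?a = "(-1) ^ k / fact k * t ^ k * g (Suc k)"
  let ?b = "(-1) ^ k / fact (Suc k) * t ^ Suc k * g (Suc (Suc k))"
  have "(\<Sum>s=1..Suc k. (-1) ^ (s - 1) / fact (s - 1) * t ^ (s - 1) * g s)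
      + (\<Sum>s=1..Suc k. (-1) ^ (s - 1) / fact s * t ^ s * g (Suc s))
    = ((\<Sum>s=1..k. (-1) ^ (s - 1) / fact (s - 1) * t ^ (s - 1) * g s)
      + (\<Sum>s=1..k. (-1) ^ (s - 1) / fact s * t ^ s * g (Suc s))) + (?a + ?b)"
    by (simp del: fact_Suc)
  then show ?case
    unfolding Suc by (simp del: fact_Suc)
qed simp

lemma index_mult_mat_left_sum:
  fixes A :: "'a::comm_ring_1 mat"
  assumes A: "A \<in> carrier_mat n n" and E: "E \<in> carrier_mat n n" and Y: "Y \<in> carrier_mat n n"
    and G: "\<And>s. s \<in> S \<Longrightarrow> G s \<in> carrier_mat n n"
    and entry: "\<And>l j. l < n \<Longrightarrow> j < n \<Longrightarrow> Y $$ (l, j) = E $$ (l, j) + (\<Sum>s\<in>S. c s * G s $$ (l, j))"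
    and ij: "i < n" "j < n"
  shows "(A * Y) $$ (i, j) = (A * E) $$ (i, j) + (\<Sum>s\<in>S. c s * (A * G s) $$ (i, j))"
proof -
  have mult: "(A * Z) $$ (i, j) = (\<Sum>l=0..<n. A $$ (i, l) * Z $$ (l, j))"
    if "Z \<in> carrier_mat n n" for Z
    using A that ij by (auto simp: scalar_prod_def intro!: sum.cong)
  have "(A * Y) $$ (i, j) = (\<Sum>l=0..<n. A $$ (i, l) * E $$ (l, j))
    + (\<Sum>l=0..<n. \<Sum>s\<in>S. c s * (A $$ (i, l) * G s $$ (l, j)))"
    unfolding mult[OF Y] sum.distrib[symmetric]
    using ij by (intro sum.cong) (auto simp: entry distrib_left sum_distrib_left ac_simps)
  also have "(\<Sum>l=0..<n. \<Sum>s\<in>S. c s * (A $$ (i, l) * G s $$ (l, j))) =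
    (\<Sum>s\<in>S. c s * (A * G s) $$ (i, j))"
    by (subst sum.swap) (intro sum.cong refl, simp add: mult G sum_distrib_left)
  finally show ?thesis by (simp add: mult[OF E])
qed

text \<open>The factor s from the power rule turns s! into (s - 1)!. The real power is
  differentiated first and carried to complex values by bounded linear maps.\<close>

lemma has_vector_derivative_power_coeff:
  fixes c :: complex
  assumes "s \<ge> 1"
  shows "((\<lambda>u. (-1) ^ (s - 1) / fact s * complex_of_real u ^ s * c) has_vector_derivative
    (-1) ^ (s - 1) / fact (s - 1) * complex_of_real t ^ (s - 1) * c) (at t)"
proof -
  obtain m where m: "s = Suc m" using assms by (cases s) auto
  have "((\<lambda>u. u ^ s) has_real_derivative real s * t ^ (s - 1)) (at t)"
    by (auto intro!: derivative_eq_intros)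
  then have "((\<lambda>u. u ^ s) has_vector_derivative real s * t ^ (s - 1)) (at t)"
    by (simp add: has_real_derivative_iff_has_vector_derivative)
  from bounded_linear.has_vector_derivative[OF bounded_linear_of_real this]
  have "((\<lambda>u. complex_of_real (u ^ s)) has_vector_derivative
      complex_of_real (real s * t ^ (s - 1))) (at t)" .
  from bounded_linear.has_vector_derivative[OF bounded_linear_mult_left
      [of "(-1) ^ (s - 1) / fact s * c"] this]
  have "((\<lambda>u. complex_of_real (u ^ s) * ((-1) ^ (s - 1) / fact s * c)) has_vector_derivative
      complex_of_real (real s * t ^ (s - 1)) * ((-1) ^ (s - 1) / fact s * c)) (at t)" .
  moreover have "complex_of_real (real s * t ^ (s - 1)) * ((-1) ^ (s - 1) / fact s * c) =
    (-1) ^ (s - 1) / fact (s - 1) * complex_of_real t ^ (s - 1) * c"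
  proof -
    have "of_nat (Suc m) / (fact (Suc m) :: complex) = 1 / fact m"
      by (simp add: fact_Suc del: of_nat_Suc)
    then show ?thesis unfolding m by (simp add: field_simps del: fact_Suc of_nat_Suc)
  qed
  ultimately show ?thesis by (simp add: ac_simps)
qed

theorem theorem4p2:
  fixes A B :: "complex mat" and n k r :: nat and X :: "real \<Rightarrow> complex mat"
  assumes A: "A \<in> carrier_mat n n"
    and B: "B \<in> carrier_mat n n"
    and singular: "\<not> invertible_mat A"
    and index: "mat_index A = k"
    and rank_Suc: "vec_space.rank n (A ^\<^sub>m (k + 1)) = r"
    and rank: "vec_space.rank n (A ^\<^sub>m k) = r"
    and r: "r \<ge> 1"
    and X: "\<And>t. X t = drazin_inverse A * B +
      (\<Oplus>\<^bsub>module_mat TYPE(complex) n n\<^esub> s \<in> {1..k}.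
         ((-1) ^ (s - 1) / fact s * complex_of_real t ^ s) \<cdot>\<^sub>m
           (A ^\<^sub>m (s - 1) * B - drazin_inverse A * A ^\<^sub>m s * B))"
  shows "solves_matrix_ode A B X \<and>
    (\<forall>t. \<forall>i<n. \<forall>j<n.
      X t $$ (i, j) =
        (\<Sum>\<beta> \<in> index_sets_through r n i.
           principal_minor (replace_col (A ^\<^sub>m (k + 1)) (col (A ^\<^sub>m k * B) j) i) \<beta>)
        / (\<Sum>\<beta> \<in> index_sets r n. principal_minor (A ^\<^sub>m (k + 1)) \<beta>)
        + (\<Sum>s = 1..k. (-1) ^ (s - 1) / fact s *
            ((A ^\<^sub>m (s - 1) * B) $$ (i, j) -
              (\<Sum>\<beta> \<in> index_sets_through r n i.
                 principal_minor (replace_col (A ^\<^sub>m (k + 1)) (col (A ^\<^sub>m (k + s) * B) j) i) \<beta>)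
              / (\<Sum>\<beta> \<in> index_sets r n. principal_minor (A ^\<^sub>m (k + 1)) \<beta>))
            * complex_of_real t ^ s))"
proof -

  \<comment> \<open>Coefficients and entries of the solution\<close>
  define D where "D = drazin_inverse A"
  have rk: "vec_space.rank n (A ^\<^sub>m Suc k) = r" using rank_Suc by simp
  have D: "D \<in> carrier_mat n n" "A ^\<^sub>m Suc k * D = A ^\<^sub>m k" "D * A * D = D" "A * D = D * A"
    using is_drazin_inverse_drazin_inverse[OF A index] rk rank A index
    by (auto simp: is_drazin_inverse_def D_def)
  have Ap: "A ^\<^sub>m l \<in> carrier_mat n n" for l using A by simp
  have DAB: "D * A ^\<^sub>m s * B \<in> carrier_mat n n" for s
    by (rule mult_carrier_mat[OF mult_carrier_mat[OF D(1) Ap] B])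
  have AB: "A ^\<^sub>m s * B \<in> carrier_mat n n" for s
    by (rule mult_carrier_mat[OF Ap B])
  have DB: "D * B \<in> carrier_mat n n" by (rule mult_carrier_mat[OF D(1) B])
  \<comment> \<open>G s is the matrix coefficient of t^s without its scalar factor.\<close>
  define G where "G s = A ^\<^sub>m (s - 1) * B - D * A ^\<^sub>m s * B" for s
  define c where "c t s = (-1) ^ (s - 1) / fact s * complex_of_real t ^ s" for t s
  have G: "G s \<in> carrier_mat n n" for s unfolding G_def by (rule minus_carrier_mat[OF DAB])
  have Gij: "G s $$ (i, j) = (A ^\<^sub>m (s - 1) * B) $$ (i, j) - (D * A ^\<^sub>m s * B) $$ (i, j)"
    if "i < n" "j < n" for s i j
    unfolding G_def using that DAB[of s] by (intro index_minus_mat) auto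
  let ?F = "\<lambda>t. finsum (module_mat TYPE(complex) n n) (\<lambda>s. c t s \<cdot>\<^sub>m G s) {1..k}"
  have XG: "X t = D * B + ?F t" for t
    unfolding X D_def[symmetric] G_def[symmetric] c_def[symmetric] ..
  have Xc: "X t \<in> carrier_mat n n" for t
    unfolding XG using finsum_module_mat(1)[of "{1..k}" "\<lambda>s. c t s \<cdot>\<^sub>m G s" n n] G DB by simp
  have Xij: "X t $$ (i, j) = (D * B) $$ (i, j) + (\<Sum>s=1..k. c t s * G s $$ (i, j))"
    if "i < n" "j < n" for t i j
  proof -
    have "X t $$ (i, j) = (D * B) $$ (i, j) + ?F t $$ (i, j)"
      unfolding XG using that finsum_module_mat(1)[of "{1..k}" "\<lambda>s. c t s \<cdot>\<^sub>m G s" n n] G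
      by (intro index_add_mat) auto
    also have "?F t $$ (i, j) = (\<Sum>s=1..k. (c t s \<cdot>\<^sub>m G s) $$ (i, j))"
      using that G by (intro finsum_module_mat(2)) auto
    also have "\<dots> = (\<Sum>s=1..k. c t s * G s $$ (i, j))"
      using that carrier_matD[OF G] by (intro sum.cong refl index_smult_mat) simp_all
    finally show ?thesis .
  qed
  have AD: "A * (D * Z) = D * (A * Z)" if "Z \<in> carrier_mat n n" for Z
    by (simp only: assoc_mult_mat[OF A D(1) that, symmetric] D(4) assoc_mult_mat[OF D(1) A that])
  have Asuc: "A * A ^\<^sub>m l = A ^\<^sub>m Suc l" for l
    using pow_mat_add[OF A, of 1 l] left_mult_one_mat[OF A] A by simp
  \<comment> \<open>Multiplication by A shifts the coefficients; s \<ge> 1 keeps s - 1 from being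
    truncated.\<close>
  have AG: "A * G s = G (Suc s)" if "s \<ge> 1" for s
  proof -
    have "A * G s = A * (A ^\<^sub>m (s - 1) * B) - A * (D * A ^\<^sub>m s * B)"
      unfolding G_def by (rule mult_minus_distrib_mat[OF A AB DAB])
    also have "A * (A ^\<^sub>m (s - 1) * B) = A ^\<^sub>m s * B"
      using that by (simp add: assoc_mult_mat[OF A Ap B, symmetric] Asuc del: pow_mat.simps)
    also have "A * (D * A ^\<^sub>m s * B) = D * A ^\<^sub>m Suc s * B"
      by (simp only: assoc_mult_mat[OF D(1) Ap B] AD[OF AB] assoc_mult_mat[OF A Ap B, symmetric] Asuc)
    finally show ?thesis by (simp add: G_def)
  qed
  \<comment> \<open>The shift ends here: D commutes with A^(k+1), and A^(k+1) D = A^k makes the two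
    terms cancel.\<close>
  have GSuck: "G (Suc k) = 0\<^sub>m n n"
  proof -
    have "D * A ^\<^sub>m Suc k = A ^\<^sub>m Suc k * D"
    proof (induction k)
      show "D * A ^\<^sub>m Suc 0 = A ^\<^sub>m Suc 0 * D"
        using A D by simp
    next
      fix l assume IH: "D * A ^\<^sub>m Suc l = A ^\<^sub>m Suc l * D"
      have "D * A ^\<^sub>m Suc (Suc l) = D * A ^\<^sub>m Suc l * A"
        using assoc_mult_mat[OF D(1) Ap A, of "Suc l"] by simp
      also have "\<dots> = A ^\<^sub>m Suc l * (A * D)"
        unfolding IH D(4) by (rule assoc_mult_mat[OF Ap D(1) A])
      also have "\<dots> = A ^\<^sub>m Suc (Suc l) * D"
        using assoc_mult_mat[OF Ap A D(1), of "Suc l"] by simp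
      finally show "D * A ^\<^sub>m Suc (Suc l) = A ^\<^sub>m Suc (Suc l) * D" .
    qed
    then show ?thesis
      unfolding G_def D(2) using AB[of k] by (auto simp del: pow_mat.simps simp: D(2))
  qed

  \<comment> \<open>Verification of the differential equation\<close>
  define X' where "X' t = mat n n (\<lambda>(i, j).
      \<Sum>s=1..k. (-1) ^ (s - 1) / fact (s - 1) * complex_of_real t ^ (s - 1) * G s $$ (i, j))" for t
  have X'c: "X' t \<in> carrier_mat n n" for t by (simp add: X'_def)
  have "has_mat_derivative X (X' t) t" for t
    unfolding has_mat_derivative_def
  proof (intro conjI allI impI)
    fix i j assume "i < dim_row (X' t)" "j < dim_col (X' t)"
    then have ij: "i < n" "j < n" using X'c[of t] by auto
    show "((\<lambda>s. X s $$ (i, j)) has_vector_derivative X' t $$ (i, j)) (at t)"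
    proof -
      \<comment> \<open>The summand 0 is the derivative of the constant term D B.\<close>
      have eq: "X' t $$ (i, j) = 0 + (\<Sum>s=1..k.
          (-1) ^ (s - 1) / fact (s - 1) * complex_of_real t ^ (s - 1) * G s $$ (i, j))"
        using ij by (simp add: X'_def)
      show ?thesis
        unfolding Xij[OF ij] c_def eq
        by (intro has_vector_derivative_add has_vector_derivative_const has_vector_derivative_sum
            has_vector_derivative_power_coeff) auto
    qed
  qed (simp only: carrier_matD[OF X'c] Xc)
  moreover have "X' t + A * X t = B" for t
  proof (rule eq_matI)
    fix i j assume "i < dim_row B" "j < dim_col B"
    then have ij: "i < n" "j < n" using B by auto
    let ?g = "\<lambda>s. G s $$ (i, j)"
    have "(A * X t) $$ (i, j) = (A * (D * B)) $$ (i, j) + (\<Sum>s=1..k. c t s * (A * G s) $$ (i, j))"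
      by (rule index_mult_mat_left_sum[OF A DB Xc G Xij ij])
    also have "(\<Sum>s=1..k. c t s * (A * G s) $$ (i, j)) = (\<Sum>s=1..k. c t s * ?g (Suc s))"
      by (intro sum.cong) (auto simp: AG)
    finally have "(X' t + A * X t) $$ (i, j) = (A * (D * B)) $$ (i, j) +
      ((\<Sum>s=1..k. (-1) ^ (s - 1) / fact (s - 1) * complex_of_real t ^ (s - 1) * ?g s) +
       (\<Sum>s=1..k. (-1) ^ (s - 1) / fact s * complex_of_real t ^ s * ?g (Suc s)))"
      using ij A Xc[of t] by (simp add: X'_def c_def)
    \<comment> \<open>The remainder contains G (k+1) = 0; what is left is D A B + (B - D A
      B).\<close>
    also have "\<dots> = (A * (D * B)) $$ (i, j) + ?g 1"
      unfolding alternating_sum_telescope[of _ ?g] GSuck using ij by simp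
    also have "A * (D * B) = D * A ^\<^sub>m 1 * B"
      using A D(1) B by (simp add: AD)
    also have "(D * A ^\<^sub>m 1 * B) $$ (i, j) + ?g 1 = B $$ (i, j)"
      using Gij[OF ij, of 1] A B by simp
    finally show "(X' t + A * X t) $$ (i, j) = B $$ (i, j)" .
  qed (use A B Xc[of t] in simp_all)
  ultimately have ode: "solves_matrix_ode A B X"
    unfolding solves_matrix_ode_def by blast

  \<comment> \<open>Determinantal form of the entries\<close>
  have minors: "(D * A ^\<^sub>m m * B) $$ (i, j) =
    (\<Sum>\<beta>\<in>index_sets_through r n i.
       principal_minor (replace_col (A ^\<^sub>m (k + 1)) (col (A ^\<^sub>m (k + m) * B) j) i) \<beta>)
    / (\<Sum>\<beta>\<in>index_sets r n. principal_minor (A ^\<^sub>m (k + 1)) \<beta>)"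
    if "i < n" "j < n" for m i j
    using drazin_entry_minors[OF A B D rk rank that, of m] by (simp only: Suc_eq_plus1)
  \<comment> \<open>The power 0 makes the constant term the case m = 0 of
    \<open>minors\<close>.\<close>
  have DB0: "D * B = D * A ^\<^sub>m 0 * B"
    using A D(1) by simp
  show ?thesis
  proof (intro conjI ode allI impI)
    fix t i j assume ij: "i < n" "j < n"
    show "X t $$ (i, j) =
        (\<Sum>\<beta> \<in> index_sets_through r n i.
           principal_minor (replace_col (A ^\<^sub>m (k + 1)) (col (A ^\<^sub>m k * B) j) i) \<beta>)
        / (\<Sum>\<beta> \<in> index_sets r n. principal_minor (A ^\<^sub>m (k + 1)) \<beta>)
        + (\<Sum>s = 1..k. (-1) ^ (s - 1) / fact s *
            ((A ^\<^sub>m (s - 1) * B) $$ (i, j) -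
              (\<Sum>\<beta> \<in> index_sets_through r n i.
                 principal_minor (replace_col (A ^\<^sub>m (k + 1)) (col (A ^\<^sub>m (k + s) * B) j) i) \<beta>)
              / (\<Sum>\<beta> \<in> index_sets r n. principal_minor (A ^\<^sub>m (k + 1)) \<beta>))
            * complex_of_real t ^ s)"
      unfolding Xij[OF ij] c_def Gij[OF ij]
      by (simp only: DB0 minors[OF ij] add_0_right mult.assoc mult.commute[of "complex_of_real t ^ _"])
  qed
qed

end
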